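(* Let $F$ and $G$ be finite simple graphs that are Sidorenko, and let $s,t\in V_F$ be distinct vertices such that $F$ is symmetric with respect to $s$ and $t$. Then the $(F,s,t)$-subdivision of $G$ is Sidorenko. If $F$ is also forcing, then the $(F,s,t)$-subdivision of $G$ is forcing as well.
   Context: All graphs are finite and simple; $V_G$, $E_G$ denote vertex and edge sets and $e_G=|E_G|$. For graphs $G,H$, $t(G,H)$ is the probability that a uniformly random map $\phi:V_G\to V_H$ is a graph homomorphism, i.e. $\{\phi(u),\phi(v)\}\in E_H$ for every $\{u,v\}\in E_G$. $K_2$ is a single edge. A graph $G$ is Sidorenko if $t(G,H)\ge t(K_2,H)^{e_G}$ for every graph $H$. A sequence of graphs $(H_n)_{n\in\mathbb N}$ of increasing order (number of vertices) is $p$-quasi-random if $t(J,H_n)=(1+o(1))\,p^{e_J}$ for every graph $J$. A graph $G$ is forcing if, for every $p\in[0,1]$, every sequence $(H_n)_{n\in\mathbb N}$ of graphs of increasing order with $t(K_2,H_n)=(1+o(1))\,p$ and $t(G,H_n)=(1+o(1))\,p^{e_G}$ is $p$-quasi-random. $F$ is symmetric with respect to distinct vertices $s,t\in V_F$ if there is an automorphism of $F$ that maps $s$ to $t$ and $t$ to $s$. The $(F,s,t)$-subdivision of $G$ is the graph obtained from $G$ by replacing each edge $\{u,v\}$ of $G$ with a copy of $F$ in which $s$ and $t$ are identified with the two endpoints $u$ and $v$ (the remaining vertices of the copies being new and distinct for distinct edges; an edge $\{u,v\}$ is present in the result only if $\{s,t\}\in E_F$). By the symmetry of $F$ this does not depend,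 up to isomorphism, on which endpoint is identified with $s$.
   Formalization: The forcing claim is proved assuming that G has at least one edge; for edgeless G the subdivision is G itself, which is never forcing, so the literal claim fails there. The Sidorenko claim carries no such assumption. *)

theory Defs
  imports "HOL-Probability.Probability" "HOL-Library.Landau_Symbols"
begin

record 'a ugraph =
  vset :: "'a set"
  eset :: "'a set set"

definition simple_graph :: "'a ugraph \<Rightarrow> bool" where
  "simple_graph G \<longleftrightarrow> finite (vset G) \<and> (\<forall>e\<in>eset G. e \<subseteq> vset G \<and> card e = 2)"

definition K2 :: "nat ugraph" where
  "K2 = \<lparr>vset = {0, 1}, eset = {{0, 1}}\<rparr>"

definition graph_hom :: "'a ugraph \<Rightarrow> 'b ugraph \<Rightarrow> ('a \<Rightarrow> 'b) \<Rightarrow> bool" where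
  "graph_hom G H \<phi> \<longleftrightarrow> (\<forall>u v. {u, v} \<in> eset G \<longrightarrow> {\<phi> u, \<phi> v} \<in> eset H)"

text \<open>Maps from \<open>V\<^sub>G\<close> to \<open>V\<^sub>H\<close> are extensional functions, so that distinct maps are counted once.
  The value is meaningful only if there is such a map, in particular whenever \<open>V\<^sub>H\<close> is nonempty.\<close>

definition hom_density :: "'a ugraph \<Rightarrow> 'b ugraph \<Rightarrow> real" where
  "hom_density G H =
     measure_pmf.prob (pmf_of_set (vset G \<rightarrow>\<^sub>E vset H)) {\<phi>. graph_hom G H \<phi>}"

text \<open>Here and below, ``every graph'' is rendered as every graph with vertices in \<^typ>\<open>nat\<close>; each
  finite graph is isomorphic to one of these, and homomorphism densities are invariant under
  isomorphism (see \<open>sidorenkoD\<close>). The host graph is required to have a vertex, as otherwise there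
  is no uniformly random map into it.\<close>

definition sidorenko :: "'a ugraph \<Rightarrow> bool" where
  "sidorenko G \<longleftrightarrow>
     (\<forall>H :: nat ugraph. simple_graph H \<and> vset H \<noteq> {} \<longrightarrow>
        hom_density G H \<ge> hom_density K2 H ^ card (eset G))"

definition increasing_graph_seq :: "(nat \<Rightarrow> 'a ugraph) \<Rightarrow> bool" where
  "increasing_graph_seq H \<longleftrightarrow>
     (\<forall>n. simple_graph (H n)) \<and> strict_mono (\<lambda>n. card (vset (H n)))"

text \<open>The relation \<open>f \<sim>[sequentially] (\<lambda>_. c)\<close> is \<open>f n = (1 + o(1)) c\<close>, also for \<open>c = 0\<close>, where both
  say that \<open>f n = 0\<close> for all large \<open>n\<close>.\<close>

definition quasi_random :: "real \<Rightarrow> (nat \<Rightarrow> 'a ugraph) \<Rightarrow> bool" where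
  "quasi_random p H \<longleftrightarrow>
     increasing_graph_seq H \<and>
     (\<forall>J :: nat ugraph. simple_graph J \<longrightarrow>
        (\<lambda>n. hom_density J (H n)) \<sim>[sequentially] (\<lambda>_. p ^ card (eset J)))"

definition forcing :: "'a ugraph \<Rightarrow> bool" where
  "forcing G \<longleftrightarrow>
     (\<forall>p\<in>{0..1}. \<forall>H :: nat \<Rightarrow> nat ugraph.
        increasing_graph_seq H \<and>
        (\<lambda>n. hom_density K2 (H n)) \<sim>[sequentially] (\<lambda>_. p) \<and>
        (\<lambda>n. hom_density G (H n)) \<sim>[sequentially] (\<lambda>_. p ^ card (eset G))
        \<longrightarrow> quasi_random p H)"

definition graph_automorphism :: "'a ugraph \<Rightarrow> ('a \<Rightarrow> 'a) \<Rightarrow> bool" where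
  "graph_automorphism F \<pi> \<longleftrightarrow>
     bij_betw \<pi> (vset F) (vset F) \<and>
     (\<forall>u\<in>vset F. \<forall>v\<in>vset F. {\<pi> u, \<pi> v} \<in> eset F \<longleftrightarrow> {u, v} \<in> eset F)"

definition symmetric_wrt :: "'a ugraph \<Rightarrow> 'a \<Rightarrow> 'a \<Rightarrow> bool" where
  "symmetric_wrt F s t \<longleftrightarrow> (\<exists>\<pi>. graph_automorphism F \<pi> \<and> \<pi> s = t \<and> \<pi> t = s)"

text \<open>An orientation records, for each edge, which endpoint is identified with \<open>s\<close> (the first
  component) and which one with \<open>t\<close> (the second).\<close>

definition orientation :: "'b ugraph \<Rightarrow> ('b set \<Rightarrow> 'b \<times> 'b) \<Rightarrow> bool" where
  "orientation G d \<longleftrightarrow> (\<forall>e\<in>eset G. e = {fst (d e), snd (d e)})"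

text \<open>The copy of \<open>F\<close> that replaces the edge \<open>e\<close>: \<open>Inl\<close> marks the vertices of \<open>G\<close>, and \<open>Inr (e, w)\<close> is
  the new vertex coming from \<open>w\<close>.\<close>

definition copy_vertex ::
  "'a \<Rightarrow> 'a \<Rightarrow> ('b set \<Rightarrow> 'b \<times> 'b) \<Rightarrow> 'b set \<Rightarrow> 'a \<Rightarrow> 'b + 'b set \<times> 'a" where
  "copy_vertex s t d e w =
     (if w = s then Inl (fst (d e)) else if w = t then Inl (snd (d e)) else Inr (e, w))"

definition subdivision ::
  "'a ugraph \<Rightarrow> 'a \<Rightarrow> 'a \<Rightarrow> ('b set \<Rightarrow> 'b \<times> 'b) \<Rightarrow> 'b ugraph \<Rightarrow> ('b + 'b set \<times> 'a) ugraph" where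
  "subdivision F s t d G =
     \<lparr>vset = Inl ` vset G \<union> Inr ` (eset G \<times> (vset F - {s, t})),
      eset = (\<Union>e\<in>eset G. (\<lambda>f. copy_vertex s t d e ` f) ` eset F)\<rparr>"

lemma hom_density_eq_card:
  assumes "simple_graph G" "simple_graph H" "vset H \<noteq> {}"
  shows "hom_density G H =
    card {\<phi> \<in> vset G \<rightarrow>\<^sub>E vset H. graph_hom G H \<phi>} / card (vset H) ^ card (vset G)"
proof -
  have fin: "finite (vset G)" "finite (vset H)"
    using assms by (auto simp: simple_graph_def)
  have "finite (vset G \<rightarrow>\<^sub>E vset H)" "vset G \<rightarrow>\<^sub>E vset H \<noteq> {}"
    using fin assms(3) by (auto intro: finite_PiE simp: PiE_eq_empty_iff)
  moreover have "card (vset G \<rightarrow>\<^sub>E vset H) = card (vset H) ^ card (vset G)"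
    using fin by (simp add: card_PiE)
  ultimately show ?thesis
    by (simp add: hom_density_def measure_pmf_of_set Int_def)
qed

lemma hom_density_iso:
  assumes G: "simple_graph G" and H: "simple_graph H" and ne: "vset H \<noteq> {}" and H': "simple_graph H'"
    and f: "bij_betw f (vset H) (vset H')"
    and fe: "\<And>u v. u \<in> vset H \<Longrightarrow> v \<in> vset H \<Longrightarrow> {f u, f v} \<in> eset H' \<longleftrightarrow> {u, v} \<in> eset H"
  shows "hom_density G H' = hom_density G H"
proof -
  have ne': "vset H' \<noteq> {}"
    using f ne by (auto simp: bij_betw_def)
  let ?A = "{\<phi> \<in> vset G \<rightarrow>\<^sub>E vset H. graph_hom G H \<phi>}"
  let ?B = "{\<phi> \<in> vset G \<rightarrow>\<^sub>E vset H'. graph_hom G H' \<phi>}"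
  define g where "g = inv_into (vset H) f"
  have g: "bij_betw g (vset H') (vset H)"
    unfolding g_def by (rule bij_betw_inv_into[OF f])
  have fg: "f (g y) = y" if "y \<in> vset H'" for y
    unfolding g_def using f that by (rule bij_betw_inv_into_right)
  have gf: "g (f x) = x" if "x \<in> vset H" for x
    unfolding g_def using f that by (rule bij_betw_inv_into_left)
  have fV: "f x \<in> vset H'" if "x \<in> vset H" for x
    using f that by (auto simp: bij_betw_def)
  have gV: "g y \<in> vset H" if "y \<in> vset H'" for y
    using g that by (auto simp: bij_betw_def)
  have inG: "u \<in> vset G" "v \<in> vset G" if "{u, v} \<in> eset G" for u v
    using G that by (auto simp: simple_graph_def)
  have "bij_betw (\<lambda>\<phi>. \<lambda>x\<in>vset G. f (\<phi> x)) ?A ?B"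
  proof (rule bij_betw_byWitness[where f' = "\<lambda>\<psi>. \<lambda>x\<in>vset G. g (\<psi> x)"])
    show "\<forall>\<phi>\<in>?A. (\<lambda>x\<in>vset G. g ((\<lambda>x\<in>vset G. f (\<phi> x)) x)) = \<phi>"
      by (auto intro!: extensionalityI[of _ "vset G"] simp: gf PiE_def Pi_def)
    show "\<forall>\<psi>\<in>?B. (\<lambda>x\<in>vset G. f ((\<lambda>x\<in>vset G. g (\<psi> x)) x)) = \<psi>"
      by (auto intro!: extensionalityI[of _ "vset G"] simp: fg PiE_def Pi_def)
    show "(\<lambda>\<phi>. \<lambda>x\<in>vset G. f (\<phi> x)) ` ?A \<subseteq> ?B"
    proof (rule image_subsetI)
      fix \<phi> assume *: "\<phi> \<in> ?A"
      have P: "\<phi> x \<in> vset H" if "x \<in> vset G" for x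
        using * that by auto
      have E: "{\<phi> u, \<phi> v} \<in> eset H" if "{u, v} \<in> eset G" for u v
        using * that by (auto simp: graph_hom_def)
      have "{f (\<phi> u), f (\<phi> v)} \<in> eset H'" if "{u, v} \<in> eset G" for u v
        using E[OF that] fe[OF P P] inG[OF that] by simp
      thus "(\<lambda>x\<in>vset G. f (\<phi> x)) \<in> ?B"
        using P fV inG by (simp add: graph_hom_def)
    qed
    show "(\<lambda>\<psi>. \<lambda>x\<in>vset G. g (\<psi> x)) ` ?B \<subseteq> ?A"
    proof (rule image_subsetI)
      fix \<psi> assume *: "\<psi> \<in> ?B"
      have P: "\<psi> x \<in> vset H'" if "x \<in> vset G" for x
        using * that by auto
      have E: "{\<psi> u, \<psi> v} \<in> eset H'" if "{u, v} \<in> eset G" for u v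
        using * that by (auto simp: graph_hom_def)
      have "{g (\<psi> u), g (\<psi> v)} \<in> eset H" if "{u, v} \<in> eset G" for u v
        using E[OF that] fe[OF gV[OF P] gV[OF P]] fg[OF P] inG[OF that] by simp
      thus "(\<lambda>x\<in>vset G. g (\<psi> x)) \<in> ?A"
        using P gV inG by (simp add: graph_hom_def)
    qed
  qed
  hence "card ?A = card ?B"
    by (rule bij_betw_same_card)
  moreover have "card (vset H) = card (vset H')"
    using f by (rule bij_betw_same_card)
  ultimately show ?thesis
    using hom_density_eq_card[OF G H ne] hom_density_eq_card[OF G H' ne'] by simp
qed

lemma simple_graph_K2: "simple_graph K2"
  by (auto simp: simple_graph_def K2_def)

lemma sidorenkoD:
  fixes H :: "'b ugraph"
  assumes "sidorenko G" and G: "simple_graph G" and H: "simple_graph H" and ne: "vset H \<noteq> {}"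
  shows "hom_density G H \<ge> hom_density K2 H ^ card (eset G)"
proof -
  have "finite (vset H)"
    using H by (simp add: simple_graph_def)
  then obtain f :: "'b \<Rightarrow> nat" where inj: "inj_on f (vset H)"
    using finite_imp_inj_to_nat_seg by metis
  define H' where "H' = \<lparr>vset = f ` vset H, eset = (\<lambda>e. f ` e) ` eset H\<rparr>"
  have H': "simple_graph H'"
    using H inj unfolding simple_graph_def H'_def
    by (auto simp: card_image inj_on_subset)
  have ne': "vset H' \<noteq> {}"
    using ne by (simp add: H'_def)
  have f: "bij_betw f (vset H) (vset H')"
    using inj by (simp add: H'_def bij_betw_def)
  have fe: "{f u, f v} \<in> eset H' \<longleftrightarrow> {u, v} \<in> eset H" if "u \<in> vset H" "v \<in> vset H" for u v
  proof
    assume "{f u, f v} \<in> eset H'"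
    then obtain e where e: "e \<in> eset H" "f ` {u, v} = f ` e"
      by (auto simp: H'_def)
    moreover have "e \<subseteq> vset H"
      using e H by (simp add: simple_graph_def)
    ultimately have "{u, v} = e"
      using inj_on_image_eq_iff[OF inj, of "{u, v}" e] that by simp
    thus "{u, v} \<in> eset H"
      using e by simp
  next
    assume "{u, v} \<in> eset H"
    hence "f ` {u, v} \<in> eset H'"
      unfolding H'_def ugraph.simps by (rule imageI)
    thus "{f u, f v} \<in> eset H'"
      by simp
  qed
  have "hom_density G H' \<ge> hom_density K2 H' ^ card (eset G)"
    using assms(1) H' ne' by (simp add: sidorenko_def)
  thus ?thesis
    by (simp add: hom_density_iso[OF G H ne H' f fe] hom_density_iso[OF simple_graph_K2 H ne H' f fe])
qed

lemma copy_vertex_inj_on: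
  assumes G: "simple_graph G" and d: "orientation G d" and e: "e \<in> eset G"
  shows "inj_on (copy_vertex s t d e) A"
proof -
  have "fst (d e) \<noteq> snd (d e)"
  proof
    assume "fst (d e) = snd (d e)"
    moreover have "e = {fst (d e), snd (d e)}" "card e = 2"
      using assms by (auto simp: orientation_def simple_graph_def)
    ultimately show False
      by (metis card_2_iff doubleton_eq_iff insert_absorb2)
  qed
  thus ?thesis
    by (auto simp: inj_on_def copy_vertex_def split: if_splits)
qed

lemma simple_graph_subdivision:
  assumes F: "simple_graph F" and G: "simple_graph G" and d: "orientation G d"
  shows "simple_graph (subdivision F s t d G)"
proof -
  have "eset G \<subseteq> Pow (vset G)"
    using G by (auto simp: simple_graph_def)
  hence "finite (eset G)"
    using G by (auto simp: simple_graph_def intro: finite_subset)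
  hence "finite (vset (subdivision F s t d G))"
    using F G by (simp add: simple_graph_def subdivision_def)
  moreover have "x \<subseteq> vset (subdivision F s t d G) \<and> card x = 2"
    if x: "x \<in> eset (subdivision F s t d G)" for x
  proof -
    obtain e f where ef: "e \<in> eset G" "f \<in> eset F" "x = copy_vertex s t d e ` f"
      using x by (auto simp: subdivision_def)
    have "f \<subseteq> vset F" "card f = 2"
      using F ef by (auto simp: simple_graph_def)
    moreover have "fst (d e) \<in> vset G" "snd (d e) \<in> vset G"
      using G d ef by (auto simp: simple_graph_def orientation_def)
    ultimately have "x \<subseteq> vset (subdivision F s t d G)"
      using ef by (auto simp: subdivision_def copy_vertex_def)
    moreover have "card x = 2"
      using ef(3) \<open>card f = 2\<close> by (simp add: card_image[OF copy_vertex_inj_on[OF G d ef(1)]])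
    ultimately show ?thesis ..
  qed
  ultimately show ?thesis
    by (simp add: simple_graph_def)
qed

end

theory Submission
  imports Defs
begin

text \<open>
  For a host graph \<open>H\<close> let \<open>W(x, y)\<close> be the probability that a random extension of \<open>s \<mapsto> x\<close>, \<open>t \<mapsto> y\<close>
  to \<open>V\<^sub>F\<close> is a homomorphism into \<open>H\<close>. By the symmetry of \<open>F\<close> this is a symmetric kernel with values in
  \<open>[0, 1]\<close> and mean \<open>t(F, H)\<close>, and the density of the subdivision in \<open>H\<close> is the density of \<open>G\<close> in \<open>W\<close>.

  The Sidorenko property of \<open>G\<close> extends from graphs to such kernels: on the \<open>m\<close>-fold blow-up of \<open>V\<^sub>H\<close>
  take a random graph with edge probabilities \<open>W\<close>, average Sidorenko's inequality, use convexity of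
  \<open>x \<mapsto> x ^ e\<^sub>G\<close>, and let \<open>m\<close> tend to infinity; only non-injective maps cause an error, which is \<open>O(1/m)\<close>.

  Hence \<open>t(K\<^sub>2, H) ^ (e\<^sub>F e\<^sub>G) \<le> t(F, H) ^ e\<^sub>G \<le> t(subdivision, H)\<close>, which is the first claim. If both ends
  are asymptotic to \<open>p ^ (e\<^sub>F e\<^sub>G)\<close>, then \<open>t(F, H)\<close> is asymptotic to \<open>p ^ e\<^sub>F\<close>, so that \<open>F\<close> being forcing
  applies.
\<close>

section \<open>Densities in kernels\<close>

text \<open>A symmetric kernel on \<open>V\<close> is a function on unordered pairs, where the singleton \<open>{x}\<close> stands for
  the diagonal entry at \<open>x\<close>.\<close>

definition kernel_density :: "'a ugraph \<Rightarrow> 'v set \<Rightarrow> ('v set \<Rightarrow> real) \<Rightarrow> real" where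
  "kernel_density G V w =
     (\<Sum>\<phi>\<in>vset G \<rightarrow>\<^sub>E V. \<Prod>e\<in>eset G. w (\<phi> ` e)) / card V ^ card (vset G)"

lemma finite_eset: "simple_graph G \<Longrightarrow> finite (eset G)"
  by (rule finite_subset[of _ "Pow (vset G)"]) (auto simp: simple_graph_def)

lemma simple_graph_edgeE:
  assumes "simple_graph G" "e \<in> eset G"
  obtains u v where "e = {u, v}" "u \<noteq> v" "u \<in> vset G" "v \<in> vset G"
  using assms by (auto simp: simple_graph_def card_2_iff)

lemma graph_hom_iff:
  assumes "simple_graph G"
  shows "graph_hom G H \<phi> \<longleftrightarrow> (\<forall>e\<in>eset G. \<phi> ` e \<in> eset H)"
proof
  assume "graph_hom G H \<phi>"
  thus "\<forall>e\<in>eset G. \<phi> ` e \<in> eset H"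
    using assms by (auto simp: graph_hom_def elim!: simple_graph_edgeE)
next
  assume *: "\<forall>e\<in>eset G. \<phi> ` e \<in> eset H"
  show "graph_hom G H \<phi>"
    unfolding graph_hom_def
  proof (intro allI impI)
    fix u v assume "{u, v} \<in> eset G"
    hence "\<phi> ` {u, v} \<in> eset H"
      using * by blast
    thus "{\<phi> u, \<phi> v} \<in> eset H"
      by simp
  qed
qed

lemma prod_of_bool:
  "finite A \<Longrightarrow> (\<Prod>x\<in>A. of_bool (P x)) = (of_bool (\<forall>x\<in>A. P x) :: real)"
  by (induction A rule: finite_induct) auto

text \<open>A graph is a kernel with values 0 and 1. Singletons are no edges, so its diagonal
  vanishes, as it must for maps that identify the ends of an edge.\<close>

lemma hom_density_eq_kernel_density:
  assumes G: "simple_graph G" and H: "simple_graph H" and ne: "vset H \<noteq> {}"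
  shows "hom_density G H = kernel_density G (vset H) (\<lambda>e. of_bool (e \<in> eset H))"
proof -
  have fin: "finite (vset G \<rightarrow>\<^sub>E vset H)"
    using G H by (auto intro: finite_PiE simp: simple_graph_def)
  show ?thesis
    using fin
    by (simp add: hom_density_eq_card[OF G H ne] kernel_density_def prod_of_bool[OF finite_eset[OF G]]
        graph_hom_iff[OF G] Int_def sum_of_bool_eq)
qed

lemma kernel_density_K2:
  assumes "finite V"
  shows "kernel_density K2 V w = (\<Sum>x\<in>V. \<Sum>y\<in>V. w {x, y}) / (card V)\<^sup>2"
proof -
  let ?D = "{0, 1} \<rightarrow>\<^sub>E V :: (nat \<Rightarrow> 'a) set"
  have "(\<Sum>\<phi>\<in>?D. w {\<phi> 0, \<phi> 1}) = (\<Sum>(x, y)\<in>V \<times> V. w {x, y})"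
    by (rule sum.reindex_bij_witness[where j = "\<lambda>\<phi>. (\<phi> 0, \<phi> 1)"
          and i = "\<lambda>(x, y). (\<lambda>i\<in>{0, 1}. if i = 0 then x else y)"])
      (auto simp: PiE_def extensional_def Pi_def fun_eq_iff)
  thus ?thesis
    by (simp add: kernel_density_def K2_def sum.cartesian_product power2_eq_square)
qed

lemma kernel_density_nonneg:
  assumes "\<And>e. 0 \<le> w e"
  shows "0 \<le> kernel_density G V w"
  using assms by (auto simp: kernel_density_def intro!: divide_nonneg_nonneg sum_nonneg prod_nonneg)

text \<open>Dropping second coordinates is \<open>m ^ card (vset G)\<close>-to-one on maps and keeps
  their weights; the normalisation grows by the same factor.\<close>

lemma kernel_density_blow_up:
  assumes G: "simple_graph G" and V: "finite V" and m: "m > 0"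
  shows "kernel_density G (V \<times> {..<m::nat}) (\<lambda>e. w (fst ` e)) = kernel_density G V w"
proof -
  let ?A = "vset G"
  let ?S = "?A \<rightarrow>\<^sub>E V \<times> {..<m}"
  let ?r = "\<lambda>\<phi>. \<lambda>a\<in>?A. fst (\<phi> a)"
  let ?h = "\<lambda>\<psi>. \<Prod>e\<in>eset G. w (\<psi> ` e)"
  have A: "finite ?A"
    using G by (simp add: simple_graph_def)
  have fS: "finite ?S" and fT: "finite (?A \<rightarrow>\<^sub>E V)"
    using A V by (auto intro!: finite_PiE)
  have h: "(\<Prod>e\<in>eset G. w (fst ` \<phi> ` e)) = ?h (?r \<phi>)" for \<phi> :: "_ \<Rightarrow> _ \<times> nat"
  proof (rule prod.cong[OF refl])
    fix e assume "e \<in> eset G"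
    hence "e \<subseteq> ?A" using G by (simp add: simple_graph_def)
    hence "fst ` \<phi> ` e = ?r \<phi> ` e" by (force simp: image_image intro!: image_cong)
    thus "w (fst ` \<phi> ` e) = w (?r \<phi> ` e)" by simp
  qed
  have fib: "{\<phi>. \<phi> \<in> ?S \<and> ?r \<phi> = \<psi>} = (\<Pi>\<^sub>E a\<in>?A. {\<psi> a} \<times> {..<m})" if "\<psi> \<in> ?A \<rightarrow>\<^sub>E V" for \<psi>
  proof (intro set_eqI iffI)
    fix \<phi> assume *: "\<phi> \<in> {\<phi>. \<phi> \<in> ?S \<and> ?r \<phi> = \<psi>}"
    have "fst (\<phi> a) = \<psi> a" if "a \<in> ?A" for a
      using * that by (auto dest: fun_cong[of _ _ a])
    thus "\<phi> \<in> (\<Pi>\<^sub>E a\<in>?A. {\<psi> a} \<times> {..<m})"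
      using * by (auto simp: PiE_iff mem_Times_iff)
  next
    fix \<phi> assume *: "\<phi> \<in> (\<Pi>\<^sub>E a\<in>?A. {\<psi> a} \<times> {..<m})"
    have "?r \<phi> = \<psi>"
      using * that by (intro extensionalityI[of _ ?A]) (auto simp: PiE_iff mem_Times_iff)
    thus "\<phi> \<in> {\<phi>. \<phi> \<in> ?S \<and> ?r \<phi> = \<psi>}"
      using * that by (auto simp: PiE_iff mem_Times_iff)
  qed
  have "(\<Sum>\<phi>\<in>?S. ?h (?r \<phi>)) = (\<Sum>\<psi>\<in>?A \<rightarrow>\<^sub>E V. \<Sum>\<phi>\<in>{\<phi>. \<phi> \<in> ?S \<and> ?r \<phi> = \<psi>}. ?h (?r \<phi>))"
    by (rule sum.group[symmetric, OF fS fT]) (auto simp: PiE_iff mem_Times_iff)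
  also have "\<dots> = (\<Sum>\<psi>\<in>?A \<rightarrow>\<^sub>E V. m ^ card ?A * ?h \<psi>)"
  proof (rule sum.cong[OF refl])
    fix \<psi> assume \<psi>: "\<psi> \<in> ?A \<rightarrow>\<^sub>E V"
    have "(\<Sum>\<phi>\<in>{\<phi>. \<phi> \<in> ?S \<and> ?r \<phi> = \<psi>}. ?h (?r \<phi>)) = (\<Sum>\<phi>\<in>{\<phi>. \<phi> \<in> ?S \<and> ?r \<phi> = \<psi>}. ?h \<psi>)"
      by (rule sum.cong) auto
    also have "\<dots> = m ^ card ?A * ?h \<psi>"
      unfolding fib[OF \<psi>] using A by (simp add: card_PiE)
    finally show "(\<Sum>\<phi>\<in>{\<phi>. \<phi> \<in> ?S \<and> ?r \<phi> = \<psi>}. ?h (?r \<phi>)) = m ^ card ?A * ?h \<psi>" .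
  qed
  finally have "(\<Sum>\<phi>\<in>?S. ?h (?r \<phi>)) = m ^ card ?A * (\<Sum>\<psi>\<in>?A \<rightarrow>\<^sub>E V. ?h \<psi>)"
    by (simp add: sum_distrib_left)
  thus ?thesis
    unfolding kernel_density_def h using m
    by (simp only:) (simp add: card_cartesian_product power_mult_distrib)
qed

section \<open>Random graphs\<close>

text \<open>The probability that a random subset of \<open>D\<close>, containing each \<open>e\<close> independently with probability
  \<open>w e\<close>, is equal to \<open>S\<close>.\<close>

definition subset_weight :: "'e set \<Rightarrow> ('e \<Rightarrow> real) \<Rightarrow> 'e set \<Rightarrow> real" where
  "subset_weight D w S = (\<Prod>e\<in>S. w e) * (\<Prod>e\<in>D - S. 1 - w e)"

lemma subset_weight_nonneg:
  assumes "\<And>e. 0 \<le> w e \<and> w e \<le> 1"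
  shows "0 \<le> subset_weight D w S"
  using assms by (auto simp: subset_weight_def intro!: mult_nonneg_nonneg prod_nonneg)

text \<open>This is the probability that the random subset contains \<open>A\<close>. The weights
  are the terms in the expansion of the product of \<open>w e + (1 - w e)\<close> over
  \<open>D\<close>; deleting \<open>1 - w e\<close> for each \<open>e \<in> A\<close> leaves exactly
  the terms with \<open>A \<subseteq> S\<close>.\<close>

lemma sum_subset_weight_superset:
  assumes D: "finite D" and A: "finite A"
  shows "(\<Sum>S\<in>Pow D. subset_weight D w S * of_bool (A \<subseteq> S)) = of_bool (A \<subseteq> D) * prod w A"
proof (cases "A \<subseteq> D")
  case True
  have "(\<Sum>S\<in>Pow D. subset_weight D w S * of_bool (A \<subseteq> S)) =
    (\<Sum>S\<in>Pow D. prod w S * (\<Prod>e\<in>D - S. (1 - w e) * of_bool (e \<notin> A)))"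
  proof (rule sum.cong[OF refl])
    fix S assume "S \<in> Pow D"
    \<comment> \<open>The event is rewritten as a condition on each element left out of
      \<open>S\<close>, so that it can be absorbed into the factors of the product.\<close>
    have "(\<forall>e\<in>D - S. e \<notin> A) \<longleftrightarrow> A \<subseteq> S"
      using True by auto
    thus "subset_weight D w S * of_bool (A \<subseteq> S) =
      prod w S * (\<Prod>e\<in>D - S. (1 - w e) * of_bool (e \<notin> A))"
      using D by (simp add: subset_weight_def prod.distrib prod_of_bool del: of_bool_not_iff)
  qed
  also have "\<dots> = (\<Prod>e\<in>D. w e + (1 - w e) * of_bool (e \<notin> A))"
    using D by (rule prod_add[symmetric])
  also have "\<dots> = (\<Prod>e\<in>D. if e \<in> A then w e else 1)"
    by (rule prod.cong) auto
  also have "\<dots> = prod w A"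
    using D True by (simp add: prod.If_cases Int_absorb1)
  finally show ?thesis using True by simp
next
  case False
  hence "\<not> A \<subseteq> S" if "S \<in> Pow D" for S
    using that by blast
  thus ?thesis using False by simp
qed

lemma sum_subset_weight:
  assumes "finite D"
  shows "(\<Sum>S\<in>Pow D. subset_weight D w S) = 1"
  using sum_subset_weight_superset[OF assms, of "{}" w] by simp

text \<open>Union bound over ordered pairs of distinct \<open>u\<close>, \<open>v\<close> with equal
  images: such a map is determined by its restriction to \<open>A - {v}\<close>. The factor
  \<open>card V\<close> on the left avoids a division.\<close>

lemma card_non_injective_le:
  assumes A: "finite A" and V: "finite V"
  shows "card {\<phi> \<in> A \<rightarrow>\<^sub>E V. \<not> inj_on \<phi> A} * card V \<le> (card A)\<^sup>2 * card V ^ card A"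
proof -
  let ?B = "\<lambda>p. {\<phi> \<in> A \<rightarrow>\<^sub>E V. \<phi> (fst p) = \<phi> (snd p)}"
  let ?P = "{p \<in> A \<times> A. fst p \<noteq> snd p}"
  have fin: "finite (A \<rightarrow>\<^sub>E V)"
    using A V by (auto intro: finite_PiE)
  have B: "card (?B p) \<le> card V ^ (card A - 1)" if p: "p \<in> ?P" for p
  proof -
    obtain u v where uv: "p = (u, v)" "u \<in> A" "v \<in> A" "u \<noteq> v"
      using p by (cases p) auto
    have "inj_on (\<lambda>\<phi>. restrict \<phi> (A - {v})) (?B p)"
    proof (rule inj_onI)
      fix \<phi> \<psi> assume *: "\<phi> \<in> ?B p" "\<psi> \<in> ?B p" "restrict \<phi> (A - {v}) = restrict \<psi> (A - {v})"
      have eq: "\<phi> a = \<psi> a" if "a \<in> A - {v}" for a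
        using fun_cong[OF *(3), of a] that by simp
      show "\<phi> = \<psi>"
      proof (rule extensionalityI[of _ A])
        fix a assume "a \<in> A"
        thus "\<phi> a = \<psi> a"
          using eq[of a] eq[of u] * uv by (cases "a = v") auto
      qed (use * in \<open>auto simp: PiE_iff\<close>)
    qed
    moreover have "(\<lambda>\<phi>. restrict \<phi> (A - {v})) ` ?B p \<subseteq> (A - {v}) \<rightarrow>\<^sub>E V"
      by (auto simp: restrict_PiE_iff split: if_splits)
    ultimately have "card (?B p) \<le> card ((A - {v}) \<rightarrow>\<^sub>E V)"
      using A V by (intro card_inj_on_le) (auto intro: finite_PiE)
    thus ?thesis
      using A uv by (simp add: card_PiE)
  qed
  have "{\<phi> \<in> A \<rightarrow>\<^sub>E V. \<not> inj_on \<phi> A} \<subseteq> (\<Union>p\<in>?P. ?B p)"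
    by (auto simp: inj_on_def)
  hence "card {\<phi> \<in> A \<rightarrow>\<^sub>E V. \<not> inj_on \<phi> A} \<le> card (\<Union>p\<in>?P. ?B p)"
    using fin A by (intro card_mono) auto
  also have "\<dots> \<le> (\<Sum>p\<in>?P. card (?B p))"
    using A by (intro card_UN_le) auto
  also have "\<dots> \<le> card ?P * card V ^ (card A - 1)"
    using sum_bounded_above[of ?P "\<lambda>p. card (?B p)", OF B] by simp
  also have "\<dots> \<le> card (A \<times> A) * card V ^ (card A - 1)"
    using A by (intro mult_right_mono card_mono) auto
  finally have "card {\<phi> \<in> A \<rightarrow>\<^sub>E V. \<not> inj_on \<phi> A} * card V
      \<le> card (A \<times> A) * (card V ^ (card A - 1) * card V)"
    by (metis mult.assoc mult_le_mono1)
  \<comment> \<open>For empty \<open>A\<close> the truncated exponent \<open>card A - 1\<close> does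
    no harm, since \<open>card (A \<times> A)\<close> vanishes.\<close>
  also have "\<dots> = (card A)\<^sup>2 * card V ^ card A"
    using A by (cases "card A") (auto simp: card_cartesian_product power2_eq_square)
  finally show ?thesis .
qed

definition vertex_pairs :: "'v set \<Rightarrow> 'v set set" where
  "vertex_pairs V = {e. e \<subseteq> V \<and> card e = 2}"

lemma finite_vertex_pairs: "finite V \<Longrightarrow> finite (vertex_pairs V)"
  by (simp add: vertex_pairs_def)

text \<open>The mean density of \<open>J\<close> in the random graph on \<open>V\<close> whose edges
  \<open>e\<close> are drawn independently with probabilities \<open>w e\<close>.\<close>

definition expected_density :: "'a ugraph \<Rightarrow> 'v set \<Rightarrow> ('v set \<Rightarrow> real) \<Rightarrow> real" where
  "expected_density J V w =
     (\<Sum>S\<in>Pow (vertex_pairs V).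
        subset_weight (vertex_pairs V) w S * kernel_density J V (\<lambda>e. of_bool (e \<in> S)))"

text \<open>An injective map sends distinct edges to distinct pairs, which are drawn independently,
  so it contributes equally to both densities. Every other map changes the unnormalised difference
  by at most 1, and \<open>card_non_injective_le\<close> bounds the number of these.\<close>

lemma expected_density_approx:
  assumes J: "simple_graph J" and V: "finite V" "V \<noteq> {}" and w: "\<And>e. 0 \<le> w e \<and> w e \<le> 1"
  shows "\<bar>expected_density J V w - kernel_density J V w\<bar> \<le> (card (vset J))\<^sup>2 / card V"
proof -
  let ?D = "vertex_pairs V"
  let ?M = "vset J \<rightarrow>\<^sub>E V"
  let ?N = "card V ^ card (vset J)"
  let ?I = "\<lambda>\<phi>. (`) \<phi> ` eset J"
  have fD: "finite ?D"
    using V(1) by (rule finite_vertex_pairs)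
  have fJ: "finite (vset J)" "finite (eset J)"
    using J by (auto simp: simple_graph_def finite_eset)
  have fM: "finite ?M"
    using fJ V by (auto intro: finite_PiE)
  \<comment> \<open>\<open>T \<phi>\<close> is the probability that \<open>\<phi>\<close> is a
    homomorphism into the random graph: coinciding images of edges count once, and a collapsed edge
    gives 0. \<open>U \<phi>\<close> is the weight of \<open>\<phi>\<close> in the kernel, with
    repetitions and diagonal values.\<close>
  define T where "T \<phi> = of_bool (?I \<phi> \<subseteq> ?D) * prod w (?I \<phi>)" for \<phi>
  define U where "U \<phi> = (\<Prod>e\<in>eset J. w (\<phi> ` e))" for \<phi>
  have "expected_density J V w = (\<Sum>S\<in>Pow ?D. \<Sum>\<phi>\<in>?M. subset_weight ?D w S * of_bool (?I \<phi> \<subseteq> S)) / ?N"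
    by (simp add: expected_density_def kernel_density_def prod_of_bool[OF fJ(2)] sum_divide_distrib sum_distrib_left
        image_subset_iff)
  also have "(\<Sum>S\<in>Pow ?D. \<Sum>\<phi>\<in>?M. subset_weight ?D w S * of_bool (?I \<phi> \<subseteq> S))
    = (\<Sum>\<phi>\<in>?M. \<Sum>S\<in>Pow ?D. subset_weight ?D w S * of_bool (?I \<phi> \<subseteq> S))"
    by (rule sum.swap)
  also have "\<dots> = (\<Sum>\<phi>\<in>?M. T \<phi>)"
    unfolding T_def using sum_subset_weight_superset[OF fD] fJ by (intro sum.cong) auto
  finally have eq: "expected_density J V w - kernel_density J V w = (\<Sum>\<phi>\<in>?M. T \<phi> - U \<phi>) / ?N"
    by (simp add: kernel_density_def U_def sum_subtractf diff_divide_distrib)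
  have TU: "\<bar>T \<phi> - U \<phi>\<bar> \<le> of_bool (\<not> inj_on \<phi> (vset J))" if \<phi>: "\<phi> \<in> ?M" for \<phi>
  proof (cases "inj_on \<phi> (vset J)")
    case True
    have sub: "e \<subseteq> vset J" "card e = 2" if "e \<in> eset J" for e
      using J that by (auto simp: simple_graph_def)
    have "\<phi> ` e \<in> ?D" if "e \<in> eset J" for e
    proof -
      have "card (\<phi> ` e) = 2"
        using card_image[OF inj_on_subset[OF True sub(1)[OF that]]] sub(2)[OF that] by simp
      thus ?thesis
        using \<phi> sub(1)[OF that] by (auto simp: vertex_pairs_def)
    qed
    moreover have "inj_on ((`) \<phi>) (eset J)"
      using True sub by (auto intro!: inj_onI simp: inj_on_image_eq_iff)
    ultimately have "T \<phi> = U \<phi>"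
      by (simp add: T_def U_def prod.reindex image_subset_iff)
    thus ?thesis using True by simp
  next
    case False
    have "0 \<le> T \<phi>" "T \<phi> \<le> 1" "0 \<le> U \<phi>" "U \<phi> \<le> 1"
      using w by (auto simp: T_def U_def intro!: prod_nonneg prod_le_1)
    thus ?thesis using False by simp
  qed
  have "\<bar>\<Sum>\<phi>\<in>?M. T \<phi> - U \<phi>\<bar> \<le> (\<Sum>\<phi>\<in>?M. of_bool (\<not> inj_on \<phi> (vset J)))"
    by (rule order_trans[OF sum_abs sum_mono[OF TU]])
  also have "\<dots> = card {\<phi> \<in> ?M. \<not> inj_on \<phi> (vset J)}"
    using fM by (simp add: Int_def sum_of_bool_eq del: of_bool_not_iff)
  finally have "\<bar>\<Sum>\<phi>\<in>?M. T \<phi> - U \<phi>\<bar> * card V \<le> card {\<phi> \<in> ?M. \<not> inj_on \<phi> (vset J)} * card V"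
    by (simp add: mult_right_mono)
  also have "\<dots> \<le> real ((card (vset J))\<^sup>2 * ?N)"
    using card_non_injective_le[OF fJ(1) V(1)] of_nat_le_iff by blast
  finally have "\<bar>\<Sum>\<phi>\<in>?M. T \<phi> - U \<phi>\<bar> * card V \<le> (card (vset J))\<^sup>2 * ?N"
    by simp
  moreover have "card V > 0"
    using V by (simp add: card_gt_0_iff)
  ultimately show ?thesis
    unfolding eq by (simp add: field_simps abs_mult)
qed

section \<open>Sidorenko's inequality passes from graphs to kernels\<close>

lemma convex_on_power_nonneg: "convex_on {0::real..} (\<lambda>x. x ^ n)"
  using convex_power_even[of n] convex_power_odd[of n] convex_on_subset by blast

text \<open>The inequality holds for every outcome of the random graph. Jensen's inequality, with
  the probabilities of the outcomes as weights, compares the power of the mean with the mean of the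
  powers.\<close>

lemma sidorenko_expected_density:
  fixes w :: "'v set \<Rightarrow> real"
  assumes sid: "sidorenko G" and G: "simple_graph G" and V: "finite V" "V \<noteq> {}"
    and w: "\<And>e. 0 \<le> w e \<and> w e \<le> 1"
  shows "expected_density K2 V w ^ card (eset G) \<le> expected_density G V w"
proof -
  let ?P = "Pow (vertex_pairs V)"
  let ?p = "subset_weight (vertex_pairs V) w"
  let ?k = "\<lambda>S. kernel_density K2 V (\<lambda>e. of_bool (e \<in> S))"
  have fin: "finite (vertex_pairs V)"
    using V(1) by (rule finite_vertex_pairs)
  have "expected_density K2 V w ^ card (eset G) \<le> (\<Sum>S\<in>?P. ?p S * ?k S ^ card (eset G))"
    unfolding expected_density_def
    using convex_on_sum[OF _ _ convex_on_power_nonneg[of "card (eset G)"], of ?P ?p ?k]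
      sum_subset_weight[OF fin, of w] subset_weight_nonneg[of w, OF w] fin
      kernel_density_nonneg[of _ K2 V]
    by auto
  also have "\<dots> \<le> expected_density G V w"
    unfolding expected_density_def
  proof (intro sum_mono mult_left_mono subset_weight_nonneg w)
    fix S assume S: "S \<in> ?P"
    define H where "H = \<lparr>vset = V, eset = S\<rparr>"
    have H: "simple_graph H" "vset H \<noteq> {}"
      using S V by (auto simp: H_def simple_graph_def vertex_pairs_def)
    show "?k S ^ card (eset G) \<le> kernel_density G V (\<lambda>e. of_bool (e \<in> S))"
      using sidorenkoD[OF sid G H] unfolding hom_density_eq_kernel_density[OF G H]
        hom_density_eq_kernel_density[OF simple_graph_K2 H] by (simp add: H_def)
  qed
  finally show ?thesis .
qed

text \<open>Blowing up keeps the kernel density but divides the error bound by \<open>Suc m\<close>.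
  Two points over the same vertex \<open>x\<close> form a genuine pair with probability
  \<open>w {x}\<close>, which is how the diagonal of the kernel enters the random graph.\<close>

lemma expected_density_blow_up_tendsto:
  fixes w :: "'v set \<Rightarrow> real"
  assumes J: "simple_graph J" and V: "finite V" "V \<noteq> {}" and w: "\<And>e. 0 \<le> w e \<and> w e \<le> 1"
  shows "(\<lambda>m. expected_density J (V \<times> {..<Suc m}) (\<lambda>e. w (fst ` e))) \<longlonglongrightarrow> kernel_density J V w"
proof -
  let ?c = "(card (vset J))\<^sup>2 / card V"
  let ?E = "\<lambda>m. expected_density J (V \<times> {..<Suc m}) (\<lambda>e. w (fst ` e))"
  have "(\<lambda>m. ?c * inverse (real (Suc m))) \<longlonglongrightarrow> ?c * 0"
    by (intro tendsto_mult tendsto_const LIMSEQ_inverse_real_of_nat)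
  hence null: "(\<lambda>m. ?c * inverse (real (Suc m))) \<longlonglongrightarrow> 0"
    by simp
  have "norm (?E m - kernel_density J V w) \<le> ?c * inverse (real (Suc m))" for m
    using expected_density_approx[OF J, of "V \<times> {..<Suc m}" "\<lambda>e. w (fst ` e)"] V w
      kernel_density_blow_up[OF J V(1), of "Suc m" w]
    by (simp add: card_cartesian_product field_simps lessThan_empty_iff)
  hence "(\<lambda>m. ?E m - kernel_density J V w) \<longlonglongrightarrow> 0"
    by (intro Lim_null_comparison[OF _ null]) (simp add: always_eventually)
  thus "?E \<longlonglongrightarrow> kernel_density J V w"
    by (rule Lim_null[THEN iffD2])
qed

lemma sidorenko_kernel_density:
  fixes w :: "'v set \<Rightarrow> real"
  assumes "sidorenko G" "simple_graph G" "finite V" "V \<noteq> {}" "\<And>e. 0 \<le> w e \<and> w e \<le> 1"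
  shows "kernel_density K2 V w ^ card (eset G) \<le> kernel_density G V w"
proof (rule LIMSEQ_le)
  show "(\<lambda>m. expected_density K2 (V \<times> {..<Suc m}) (\<lambda>e. w (fst ` e)) ^ card (eset G))
    \<longlonglongrightarrow> kernel_density K2 V w ^ card (eset G)"
    by (intro tendsto_power expected_density_blow_up_tendsto simple_graph_K2 assms)
  show "(\<lambda>m. expected_density G (V \<times> {..<Suc m}) (\<lambda>e. w (fst ` e))) \<longlonglongrightarrow> kernel_density G V w"
    by (intro expected_density_blow_up_tendsto assms)
  have "V \<times> {..<Suc m} \<noteq> {}" for m
    using assms by auto
  thus "\<exists>N. \<forall>m\<ge>N. expected_density K2 (V \<times> {..<Suc m}) (\<lambda>e. w (fst ` e)) ^ card (eset G)
      \<le> expected_density G (V \<times> {..<Suc m}) (\<lambda>e. w (fst ` e))"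
    using assms by (intro exI[of _ 0] allI impI sidorenko_expected_density) auto
qed

section \<open>Subdivisions\<close>

text \<open>Divided by \<open>card (vset H) ^ (card (vset F) - 2)\<close>, the size of this set is
  the kernel value \<open>W(x, y)\<close>.\<close>

definition rooted_homs :: "'a ugraph \<Rightarrow> 'a \<Rightarrow> 'a \<Rightarrow> 'v ugraph \<Rightarrow> 'v \<Rightarrow> 'v \<Rightarrow> ('a \<Rightarrow> 'v) set" where
  "rooted_homs F s t H x y =
     {\<phi> \<in> vset F \<rightarrow>\<^sub>E vset H. graph_hom F H \<phi> \<and> \<phi> s = x \<and> \<phi> t = y}"

text \<open>A rooted homomorphism is determined by its values off the roots. This bounds the kernel
  by 1.\<close>

lemma card_rooted_homs_le:
  assumes F: "simple_graph F" and H: "simple_graph H" and st: "s \<in> vset F" "t \<in> vset F" "s \<noteq> t"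
  shows "card (rooted_homs F s t H x y) \<le> card (vset H) ^ (card (vset F) - 2)"
proof -
  let ?A = "vset F - {s, t}"
  have fin: "finite (vset F)" "finite (vset H)"
    using F H by (auto simp: simple_graph_def)
  have "inj_on (\<lambda>\<phi>. restrict \<phi> ?A) (rooted_homs F s t H x y)"
  proof (rule inj_onI)
    fix \<phi> \<psi>
    assume *: "\<phi> \<in> rooted_homs F s t H x y" "\<psi> \<in> rooted_homs F s t H x y"
      "restrict \<phi> ?A = restrict \<psi> ?A"
    show "\<phi> = \<psi>"
    proof (rule extensionalityI[of _ "vset F"])
      fix a assume a: "a \<in> vset F"
      show "\<phi> a = \<psi> a"
      proof (cases "a \<in> {s, t}")
        case False
        thus ?thesis
          using fun_cong[OF *(3), of a] a by simp
      qed (use * in \<open>auto simp: rooted_homs_def\<close>)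
    qed (use * in \<open>auto simp: rooted_homs_def PiE_iff\<close>)
  qed
  moreover have "(\<lambda>\<phi>. restrict \<phi> ?A) ` rooted_homs F s t H x y \<subseteq> ?A \<rightarrow>\<^sub>E vset H"
    by (auto simp: rooted_homs_def restrict_PiE_iff split: if_splits)
  ultimately have "card (rooted_homs F s t H x y) \<le> card (?A \<rightarrow>\<^sub>E vset H)"
    using fin by (intro card_inj_on_le) (auto intro: finite_PiE)
  thus ?thesis
    using fin st by (simp add: card_PiE card_Diff_subset numeral_2_eq_2)
qed

text \<open>Precomposition with the automorphism that swaps \<open>s\<close> and \<open>t\<close> is
  injective and exchanges the roles of \<open>x\<close> and \<open>y\<close>. Used in both
  directions, this gives the symmetry of the kernel.\<close>

lemma card_rooted_homs_le_swap:
  assumes F: "simple_graph F" and H: "simple_graph H" and st: "s \<in> vset F" "t \<in> vset F"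
    and sym: "symmetric_wrt F s t"
  shows "card (rooted_homs F s t H x y) \<le> card (rooted_homs F s t H y x)"
proof -
  obtain \<pi> where \<pi>: "bij_betw \<pi> (vset F) (vset F)" "\<pi> s = t" "\<pi> t = s"
    and edge: "\<And>u v. u \<in> vset F \<Longrightarrow> v \<in> vset F \<Longrightarrow> {\<pi> u, \<pi> v} \<in> eset F \<longleftrightarrow> {u, v} \<in> eset F"
    using sym by (auto simp: symmetric_wrt_def graph_automorphism_def)
  have fin: "finite (vset F)" "finite (vset H)"
    using F H by (auto simp: simple_graph_def)
  have \<pi>V: "\<pi> a \<in> vset F" if "a \<in> vset F" for a
    using \<pi>(1) that by (auto simp: bij_betw_def)
  have inV: "u \<in> vset F" "v \<in> vset F" if "{u, v} \<in> eset F" for u v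
    using F that by (auto simp: simple_graph_def)
  let ?f = "\<lambda>\<phi>. \<lambda>a\<in>vset F. \<phi> (\<pi> a)"
  show ?thesis
  proof (rule card_inj_on_le)
    show "inj_on ?f (rooted_homs F s t H x y)"
    proof (rule inj_onI)
      fix \<phi> \<psi>
      assume *: "\<phi> \<in> rooted_homs F s t H x y" "\<psi> \<in> rooted_homs F s t H x y" "?f \<phi> = ?f \<psi>"
      show "\<phi> = \<psi>"
      proof (rule extensionalityI[of _ "vset F"])
        fix a assume "a \<in> vset F"
        then obtain b where "b \<in> vset F" "a = \<pi> b"
          using \<pi>(1) by (auto simp: bij_betw_def)
        thus "\<phi> a = \<psi> a"
          using fun_cong[OF *(3), of b] by simp
      qed (use * in \<open>auto simp: rooted_homs_def PiE_iff\<close>)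
    qed
    show "?f ` rooted_homs F s t H x y \<subseteq> rooted_homs F s t H y x"
      using \<pi> \<pi>V edge st by (auto simp: rooted_homs_def graph_hom_def dest: inV)
    show "finite (rooted_homs F s t H y x)"
      using fin by (auto simp: rooted_homs_def intro!: finite_subset[OF _ finite_PiE[of "vset F" "\<lambda>_. vset H"]])
  qed
qed

lemma card_homs_eq_sum_rooted:
  assumes F: "simple_graph F" and H: "simple_graph H" and st: "s \<in> vset F" "t \<in> vset F"
  shows "card {\<phi> \<in> vset F \<rightarrow>\<^sub>E vset H. graph_hom F H \<phi>} =
    (\<Sum>x\<in>vset H. \<Sum>y\<in>vset H. card (rooted_homs F s t H x y))"
proof -
  let ?S = "{\<phi> \<in> vset F \<rightarrow>\<^sub>E vset H. graph_hom F H \<phi>}"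
  let ?V = "vset H"
  have fin: "finite (vset F)" "finite (vset H)"
    using F H by (auto simp: simple_graph_def)
  have fS: "finite ?S"
    using fin by (auto intro!: finite_subset[OF _ finite_PiE[of "vset F" "\<lambda>_. vset H"]])
  have "(\<Sum>p\<in>?V \<times> ?V. \<Sum>\<phi>\<in>{\<phi>. \<phi> \<in> ?S \<and> (\<phi> s, \<phi> t) = p}. 1) = (\<Sum>\<phi>\<in>?S. 1::nat)"
    using fin st by (intro sum.group[OF fS]) auto
  moreover have "{\<phi>. \<phi> \<in> ?S \<and> (\<phi> s, \<phi> t) = p} = rooted_homs F s t H (fst p) (snd p)" for p
    by (auto simp: rooted_homs_def)
  ultimately show ?thesis
    by (simp add: sum.cartesian_product case_prod_beta)
qed

text \<open>A homomorphism from the subdivision amounts to an arbitrary map \<open>\<psi>\<close> on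
  the vertices of \<open>G\<close> together with, independently for each edge, a homomorphism from
  \<open>F\<close> whose root values are prescribed by \<open>\<psi>\<close>.\<close>

lemma card_homs_subdivision:
  assumes F: "simple_graph F" and G: "simple_graph G" and H: "simple_graph H"
    and st: "s \<in> vset F" "t \<in> vset F" "s \<noteq> t" and d: "orientation G d"
  shows "card {\<phi> \<in> vset (subdivision F s t d G) \<rightarrow>\<^sub>E vset H. graph_hom (subdivision F s t d G) H \<phi>} =
    (\<Sum>\<psi>\<in>vset G \<rightarrow>\<^sub>E vset H. \<Prod>e\<in>eset G. card (rooted_homs F s t H (\<psi> (fst (d e))) (\<psi> (snd (d e)))))"
proof -
  let ?K = "subdivision F s t d G"
  let ?c = "copy_vertex s t d"
  let ?S = "{\<phi> \<in> vset ?K \<rightarrow>\<^sub>E vset H. graph_hom ?K H \<phi>}"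
  let ?R = "\<lambda>\<psi>. \<Pi>\<^sub>E e\<in>eset G. rooted_homs F s t H (\<psi> (fst (d e))) (\<psi> (snd (d e)))"
  let ?T = "Sigma (vset G \<rightarrow>\<^sub>E vset H) ?R"
  let ?f = "\<lambda>\<phi>. (\<lambda>v\<in>vset G. \<phi> (Inl v), \<lambda>e\<in>eset G. \<lambda>w\<in>vset F. \<phi> (?c e w))"
  let ?g = "\<lambda>(\<psi>, \<xi>). \<lambda>z\<in>vset ?K. case z of Inl v \<Rightarrow> \<psi> v | Inr (e, w) \<Rightarrow> \<xi> e w"
  have K: "simple_graph ?K"
    using F G d by (rule simple_graph_subdivision)
  have fin: "finite (vset F)" "finite (vset G)" "finite (vset H)" "finite (eset G)"
    using F G H by (auto simp: simple_graph_def finite_eset)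
  have dV: "fst (d e) \<in> vset G" "snd (d e) \<in> vset G" if "e \<in> eset G" for e
    using G d that by (auto simp: simple_graph_def orientation_def)
  have cV: "?c e w \<in> vset ?K" if "e \<in> eset G" "w \<in> vset F" for e w
    using that dV by (auto simp: subdivision_def copy_vertex_def)
  have c_simps: "?c e s = Inl (fst (d e))" "?c e t = Inl (snd (d e))" for e
    using st by (auto simp: copy_vertex_def)
  have homK: "graph_hom ?K H \<phi> \<longleftrightarrow> (\<forall>e\<in>eset G. \<forall>f\<in>eset F. (\<lambda>w. \<phi> (?c e w)) ` f \<in> eset H)" for \<phi>
    unfolding graph_hom_iff[OF K] by (simp add: subdivision_def image_image)
  have fV: "f \<subseteq> vset F" if "f \<in> eset F" for f
    using F that by (simp add: simple_graph_def)
  have glue: "?g (\<psi>, \<xi>) (?c e w) = \<xi> e w"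
    if "\<xi> \<in> ?R \<psi>" "e \<in> eset G" "w \<in> vset F" for \<psi> \<xi> e w
  proof -
    have "\<xi> e s = \<psi> (fst (d e))" "\<xi> e t = \<psi> (snd (d e))"
      using that by (auto simp: PiE_iff rooted_homs_def)
    thus ?thesis
      using cV[OF that(2,3)] by (auto simp: copy_vertex_def)
  qed
  have "bij_betw ?f ?S ?T"
  proof (rule bij_betw_byWitness[where f' = ?g])
    show "\<forall>\<phi>\<in>?S. ?g (?f \<phi>) = \<phi>"
    proof
      fix \<phi> assume \<phi>: "\<phi> \<in> ?S"
      show "?g (?f \<phi>) = \<phi>"
      proof (rule extensionalityI[of _ "vset ?K"])
        fix z assume "z \<in> vset ?K"
        thus "?g (?f \<phi>) z = \<phi> z"
          by (auto simp: subdivision_def copy_vertex_def split: if_splits)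
      qed (use \<phi> in \<open>auto simp: PiE_def\<close>)
    qed
    show "\<forall>p\<in>?T. ?f (?g p) = p"
    proof
      fix p assume "p \<in> ?T"
      then obtain \<psi> \<xi> where p: "p = (\<psi>, \<xi>)" and \<psi>: "\<psi> \<in> vset G \<rightarrow>\<^sub>E vset H" and \<xi>: "\<xi> \<in> ?R \<psi>"
        by (rule SigmaE)
      have "(\<lambda>v\<in>vset G. ?g (\<psi>, \<xi>) (Inl v)) = \<psi>"
        using \<psi> by (intro extensionalityI[of _ "vset G"]) (auto simp: subdivision_def PiE_iff)
      moreover have "(\<lambda>e\<in>eset G. \<lambda>w\<in>vset F. ?g (\<psi>, \<xi>) (?c e w)) = \<xi>"
      proof (rule extensionalityI[of _ "eset G"])
        fix e assume e: "e \<in> eset G"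
        have "\<xi> e \<in> extensional (vset F)"
          using \<xi> e by (auto simp: PiE_iff rooted_homs_def)
        hence "(\<lambda>w\<in>vset F. ?g (\<psi>, \<xi>) (?c e w)) = \<xi> e"
          using glue[OF \<xi> e] by (intro extensionalityI[of _ "vset F"]) simp_all
        thus "(\<lambda>e\<in>eset G. \<lambda>w\<in>vset F. ?g (\<psi>, \<xi>) (?c e w)) e = \<xi> e"
          using e by simp
      qed (use \<xi> in \<open>auto simp: PiE_iff\<close>)
      ultimately show "?f (?g p) = p"
        unfolding p by simp
    qed
    show "?f ` ?S \<subseteq> ?T"
    proof (rule image_subsetI)
      fix \<phi> assume \<phi>: "\<phi> \<in> ?S"
      have V: "\<phi> z \<in> vset H" if "z \<in> vset ?K" for z
        using \<phi> that by auto
      have "(\<lambda>w\<in>vset F. \<phi> (?c e w)) \<in> rooted_homs F s t H (\<phi> (Inl (fst (d e)))) (\<phi> (Inl (snd (d e))))"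
        if e: "e \<in> eset G" for e
      proof -
        have "(\<lambda>w\<in>vset F. \<phi> (?c e w)) ` f = (\<lambda>w. \<phi> (?c e w)) ` f" if "f \<in> eset F" for f
          using fV[OF that] by (intro image_cong) auto
        hence "graph_hom F H (\<lambda>w\<in>vset F. \<phi> (?c e w))"
          using \<phi> e by (auto simp: graph_hom_iff[OF F] homK)
        thus ?thesis
          using V[OF cV[OF e]] st by (simp add: rooted_homs_def c_simps)
      qed
      moreover have "Inl v \<in> vset ?K" if "v \<in> vset G" for v
        using that by (simp add: subdivision_def)
      ultimately show "?f \<phi> \<in> ?T"
        using V dV by simp
    qed
    show "?g ` ?T \<subseteq> ?S"
    proof (rule image_subsetI)
      fix p assume "p \<in> ?T"
      then obtain \<psi> \<xi> where p: "p = (\<psi>, \<xi>)" and \<psi>: "\<psi> \<in> vset G \<rightarrow>\<^sub>E vset H" and \<xi>: "\<xi> \<in> ?R \<psi>"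
        by (rule SigmaE)
      have \<xi>e: "\<xi> e \<in> vset F \<rightarrow>\<^sub>E vset H" "graph_hom F H (\<xi> e)" if "e \<in> eset G" for e
        using \<xi> that by (auto simp: PiE_iff rooted_homs_def)
      have "?g (\<psi>, \<xi>) \<in> vset ?K \<rightarrow>\<^sub>E vset H"
        using \<psi> \<xi>e(1) by (fastforce simp: subdivision_def)
      moreover have "(\<lambda>w. ?g (\<psi>, \<xi>) (?c e w)) ` f \<in> eset H" if "e \<in> eset G" "f \<in> eset F" for e f
      proof -
        have "(\<lambda>w. ?g (\<psi>, \<xi>) (?c e w)) ` f = \<xi> e ` f"
          using fV[OF that(2)] by (intro image_cong[OF refl] glue[OF \<xi> that(1)]) blast
        thus ?thesis
          using \<xi>e(2)[OF that(1)] that(2) by (simp add: graph_hom_iff[OF F])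
      qed
      ultimately show "?g p \<in> ?S"
        unfolding p mem_Collect_eq homK by blast
    qed
  qed
  hence "card ?S = card ?T"
    by (rule bij_betw_same_card)
  also have "\<dots> = (\<Sum>\<psi>\<in>vset G \<rightarrow>\<^sub>E vset H. card (?R \<psi>))"
  proof (rule card_SigmaI)
    show "finite (vset G \<rightarrow>\<^sub>E vset H)"
      using fin by (auto intro: finite_PiE)
    have "finite (rooted_homs F s t H x y)" for x y
      using fin by (auto simp: rooted_homs_def intro!: finite_subset[OF _ finite_PiE[of "vset F" "\<lambda>_. vset H"]])
    thus "\<forall>\<psi>\<in>vset G \<rightarrow>\<^sub>E vset H. finite (?R \<psi>)"
      using fin by (auto intro: finite_PiE)
  qed
  finally show ?thesis
    using fin by (simp add: card_PiE)
qed

lemma card_vset_subdivision: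
  assumes "simple_graph F" "simple_graph G" "s \<in> vset F" "t \<in> vset F" "s \<noteq> t"
  shows "card (vset (subdivision F s t d G)) = card (vset G) + card (eset G) * (card (vset F) - 2)"
proof -
  have fin: "finite (vset F)" "finite (vset G)" "finite (eset G)"
    using assms by (auto simp: simple_graph_def finite_eset)
  have "card (vset (subdivision F s t d G)) =
    card (Inl ` vset G :: ('b + 'b set \<times> 'a) set) +
    card (Inr ` (eset G \<times> (vset F - {s, t})) :: ('b + 'b set \<times> 'a) set)"
    unfolding subdivision_def ugraph.simps using fin by (intro card_Un_disjoint) auto
  thus ?thesis
    using fin assms by (simp add: card_image card_cartesian_product card_Diff_subset numeral_2_eq_2)
qed

text \<open>Distinct copies of \<open>F\<close> share no edge: an edge with a new vertex reveals its
  copy through the tag of that vertex, and an edge without new vertices comes from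
  \<open>{s, t}\<close> and is the replaced edge of \<open>G\<close> itself.\<close>

lemma card_eset_subdivision:
  assumes F: "simple_graph F" and G: "simple_graph G" and d: "orientation G d"
  shows "card (eset (subdivision F s t d G)) = card (eset F) * card (eset G)"
proof -
  let ?c = "copy_vertex s t d"
  let ?E = "\<lambda>e. (\<lambda>f. ?c e ` f) ` eset F"
  have fin: "finite (eset F)" "finite (eset G)"
    using F G by (auto simp: finite_eset)
  have card_E: "card (?E e) = card (eset F)" if "e \<in> eset G" for e
    using inj_on_image_eq_iff[OF copy_vertex_inj_on[OF G d that, of s t UNIV]]
    by (intro card_image inj_onI) auto
  have "?E e \<inter> ?E e' = {}" if e: "e \<in> eset G" "e' \<in> eset G" "e \<noteq> e'" for e e'
  proof (rule ccontr)
    assume "?E e \<inter> ?E e' \<noteq> {}"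
    then obtain f f' where f: "f \<in> eset F" "f' \<in> eset F" "?c e ` f = ?c e' ` f'"
      by auto
    have new: "w \<in> {s, t}"
      if "?c e1 ` f1 = ?c e2 ` f2" "w \<in> f1" "e1 \<noteq> e2" for e1 e2 f1 f2 w
    proof (rule ccontr)
      assume "w \<notin> {s, t}"
      hence "?c e1 w = Inr (e1, w)"
        by (simp add: copy_vertex_def)
      hence "Inr (e1, w) \<in> ?c e2 ` f2"
        using imageI[OF that(2), of "?c e1"] that(1) by metis
      thus False
        using that(3) by (auto simp: copy_vertex_def split: if_splits)
    qed
    have Inl: "?c e1 ` f1 = Inl ` e1" if e1: "e1 \<in> eset G" and f1: "f1 \<in> eset F" "f1 \<subseteq> {s, t}" for e1 f1
    proof -
      obtain u v where "f1 = {u, v}" "u \<noteq> v"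
        using F f1(1) by (rule simple_graph_edgeE)
      hence "f1 = {s, t}" "s \<noteq> t"
        using f1(2) by auto
      hence "?c e1 ` f1 = Inl ` {fst (d e1), snd (d e1)}"
        by (simp add: copy_vertex_def insert_commute)
      moreover have "{fst (d e1), snd (d e1)} = e1"
        using d e1 by (simp add: orientation_def)
      ultimately show ?thesis
        by simp
    qed
    have "f \<subseteq> {s, t}" "f' \<subseteq> {s, t}"
      using new[OF f(3)] new[OF f(3)[symmetric]] e(3) by auto
    hence "(Inl ` e :: ('b + 'b set \<times> 'a) set) = Inl ` e'"
      using Inl[OF e(1) f(1)] Inl[OF e(2) f(2)] f(3) by simp
    thus False
      using e(3) by (simp add: inj_image_eq_iff)
  qed
  hence "card (\<Union>e\<in>eset G. ?E e) = (\<Sum>e\<in>eset G. card (?E e))"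
    using fin by (intro card_UN_disjoint) auto
  thus ?thesis
    using card_E by (simp add: subdivision_def mult.commute)
qed

text \<open>For the kernel \<open>w\<close> built from rooted homomorphisms, the left side is a
  power of its \<open>K2\<close> density and the right side is its \<open>G\<close> density.\<close>

lemma hom_density_subdivision_ge:
  assumes F: "simple_graph F" and G: "simple_graph G" and sid: "sidorenko G"
    and st: "s \<in> vset F" "t \<in> vset F" "s \<noteq> t" and sym: "symmetric_wrt F s t"
    and d: "orientation G d" and H: "simple_graph H" and ne: "vset H \<noteq> {}"
  shows "hom_density F H ^ card (eset G) \<le> hom_density (subdivision F s t d G) H"
proof -
  let ?V = "vset H"
  let ?r = "\<lambda>x y. card (rooted_homs F s t H x y)"
  define N where "N = real (card ?V) ^ (card (vset F) - 2)"
  \<comment> \<open>The choice orders the pair \<open>e\<close> arbitrarily; by \<open>swap\<close>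
    the value does not depend on it. On sets that are no pairs the value is arbitrary but still in
    \<open>[0, 1]\<close>, as the kernel lemmas require for all \<open>e\<close>.\<close>
  define w where "w e = (let p = (SOME p. e = {fst p, snd p}) in ?r (fst p) (snd p) / N)" for e
  have fin: "finite (vset F)" "finite ?V"
    using F H by (auto simp: simple_graph_def)
  have N: "N > 0"
    using fin ne by (simp add: N_def card_gt_0_iff)
  have swap: "?r x y = ?r y x" for x y
    using card_rooted_homs_le_swap[OF F H st(1,2) sym] by (meson antisym)
  have w_pair: "w {x, y} = ?r x y / N" for x y
  proof -
    define p where "p = (SOME p. {x, y} = {fst p, snd p})"
    have "{x, y} = {fst p, snd p}"
      unfolding p_def by (rule someI[of _ "(x, y)"]) simp
    hence "?r (fst p) (snd p) = ?r x y"
      using swap by (auto simp: doubleton_eq_iff)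
    thus ?thesis
      by (simp add: w_def Let_def flip: p_def)
  qed
  have w: "0 \<le> w e \<and> w e \<le> 1" for e
  proof -
    have "real (?r x y) \<le> N" for x y
      using card_rooted_homs_le[OF F H st, of x y] by (simp add: N_def flip: of_nat_power)
    thus ?thesis
      using N by (simp add: w_def Let_def)
  qed
  \<comment> \<open>\<open>F\<close> has at least two vertices, so the subtraction in the exponent
    of \<open>N\<close> is exact.\<close>
  have "card {s, t} \<le> card (vset F)"
    using fin st by (intro card_mono) auto
  hence "card (vset F) = (card (vset F) - 2) + 2"
    using st by simp
  hence NV: "real (card ?V) ^ card (vset F) = N * (card ?V)\<^sup>2"
    unfolding N_def by (metis of_nat_power power_add)
  have "hom_density F H = (\<Sum>x\<in>?V. \<Sum>y\<in>?V. w {x, y}) / (card ?V)\<^sup>2"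
    using N by (simp add: hom_density_eq_card[OF F H ne] card_homs_eq_sum_rooted[OF F H st(1,2)]
        w_pair NV flip: sum_divide_distrib)
  hence F_eq: "hom_density F H = kernel_density K2 ?V w"
    using fin by (simp add: kernel_density_K2)
  have "(\<Prod>e\<in>eset G. w (\<psi> ` e)) =
    (\<Prod>e\<in>eset G. ?r (\<psi> (fst (d e))) (\<psi> (snd (d e)))) / N ^ card (eset G)" for \<psi>
  proof -
    have "w (\<psi> ` e) = ?r (\<psi> (fst (d e))) (\<psi> (snd (d e))) / N" if "e \<in> eset G" for e
    proof -
      have "e = {fst (d e), snd (d e)}"
        using d that by (simp add: orientation_def)
      hence "\<psi> ` e = {\<psi> (fst (d e)), \<psi> (snd (d e))}"
        by (metis image_empty image_insert)
      thus ?thesis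
        by (simp add: w_pair)
    qed
    thus ?thesis
      by (simp add: prod_dividef)
  qed
  \<comment> \<open>The denominator \<open>N ^ card (eset G)\<close> accounts for the free choice of
    images of the new vertices.\<close>
  hence "kernel_density G ?V w = hom_density (subdivision F s t d G) H"
    by (simp add: kernel_density_def hom_density_eq_card[OF simple_graph_subdivision[OF F G d] H ne]
        card_homs_subdivision[OF F G H st d] card_vset_subdivision[OF F G st] power_add power_mult
        N_def mult.commute flip: sum_divide_distrib power_mult)
  thus ?thesis
    using sidorenko_kernel_density[OF sid G fin(2) ne, of w] w unfolding F_eq by simp
qed

section \<open>Asymptotics of sandwiched densities\<close>

lemma asymp_equiv_of_power_sandwich:
  fixes a f g :: "nat \<Rightarrow> real"
  assumes a: "a \<sim>[sequentially] (\<lambda>_. p)" and g: "g \<sim>[sequentially] (\<lambda>_. p ^ (j * k))"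
    and k: "k > 0" and nonneg: "\<And>n. 0 \<le> f n" "0 \<le> p"
    and le: "\<forall>\<^sub>F n in sequentially. a n ^ (j * k) \<le> f n ^ k"
      "\<forall>\<^sub>F n in sequentially. f n ^ k \<le> g n"
  shows "f \<sim>[sequentially] (\<lambda>_. p ^ j)"
proof (cases "p ^ j = 0")
  \<comment> \<open>Here convergence is not enough: equivalence to 0 means being eventually equal to
    0, which passes from \<open>g\<close> down to \<open>f\<close>.\<close>
  case True
  hence "\<forall>\<^sub>F n in sequentially. g n = 0"
    using g k by (simp add: power_0_left split: if_splits)
  hence "\<forall>\<^sub>F n in sequentially. f n = 0"
    using le(2)
  proof eventually_elim
    case (elim n)
    hence "f n ^ k = 0"
      using nonneg(1)[of n] by (intro antisym) auto
    thus ?case by simp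
  qed
  thus ?thesis
    unfolding True by simp
next
  case False
  have "(\<lambda>n. a n ^ (j * k)) \<longlonglongrightarrow> p ^ (j * k)"
    using asymp_equivD_const[OF a] by (rule tendsto_power)
  moreover have "g \<longlonglongrightarrow> p ^ (j * k)"
    using g by (rule asymp_equivD_const)
  ultimately have "(\<lambda>n. f n ^ k) \<longlonglongrightarrow> p ^ (j * k)"
    using le by (rule tendsto_sandwich[rotated 2])
  \<comment> \<open>Since \<open>k > 0\<close> and all bases are nonnegative, the
    \<open>k\<close>-th root undoes the power.\<close>
  hence "(\<lambda>n. root k (f n ^ k)) \<longlonglongrightarrow> root k (p ^ (j * k))"
    by (rule tendsto_real_root)
  hence "f \<longlonglongrightarrow> p ^ j"
    using k nonneg by (simp add: real_root_power_cancel power_mult)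
  thus ?thesis
    using False by (rule tendsto_imp_asymp_equiv_const)
qed

text \<open>The condition \<open>eset G \<noteq> {}\<close> excludes edgeless \<open>G\<close>: the
  subdivision would then be edgeless too, with density 1 in every host that has a vertex, and could
  not force quasi-randomness.\<close>

theorem theorem1p2:
  fixes F :: "'a ugraph" and G :: "'b ugraph" and s t :: 'a
    and d :: "'b set \<Rightarrow> 'b \<times> 'b"
  assumes "simple_graph F" and "simple_graph G"
    and "sidorenko F" and "sidorenko G"
    and "s \<in> vset F" and "t \<in> vset F" and "s \<noteq> t"
    and "symmetric_wrt F s t"
    and "orientation G d"
  shows "sidorenko (subdivision F s t d G) \<and>
    (forcing F \<and> eset G \<noteq> {} \<longrightarrow> forcing (subdivision F s t d G))"
proof -
  let ?K = "subdivision F s t d G"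
  let ?j = "card (eset F)" and ?k = "card (eset G)"
  have K: "card (eset ?K) = ?j * ?k"
    using assms by (intro card_eset_subdivision)
  have lower: "hom_density K2 H ^ (?j * ?k) \<le> hom_density F H ^ ?k"
    if "simple_graph H" "vset H \<noteq> {}" for H :: "nat ugraph"
    using sidorenkoD[OF assms(3,1) that]
    unfolding power_mult by (intro power_mono) (auto simp: hom_density_def)
  have upper: "hom_density F H ^ ?k \<le> hom_density ?K H"
    if "simple_graph H" "vset H \<noteq> {}" for H :: "nat ugraph"
    using assms that by (intro hom_density_subdivision_ge)
  have "sidorenko ?K"
    unfolding sidorenko_def K using lower upper order_trans by blast
  moreover have "forcing ?K" if forc: "forcing F" and ne: "eset G \<noteq> {}"
    unfolding forcing_def
  proof (intro ballI allI impI, elim conjE)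
    fix p :: real and H :: "nat \<Rightarrow> nat ugraph"
    assume p: "p \<in> {0..1}" and H: "increasing_graph_seq H"
      and a: "(\<lambda>n. hom_density K2 (H n)) \<sim>[sequentially] (\<lambda>_. p)"
      and g: "(\<lambda>n. hom_density ?K (H n)) \<sim>[sequentially] (\<lambda>_. p ^ card (eset ?K))"
    have Hn: "simple_graph (H n)" for n
      using H by (simp add: increasing_graph_seq_def)
    \<comment> \<open>\<open>H 0\<close> may have no vertices; strict growth makes all later hosts
      nonempty, so both bounds hold from index 1 on.\<close>
    have "card (vset (H 0)) < card (vset (H n))" if "n \<ge> 1" for n
      using H that by (auto simp: increasing_graph_seq_def intro: strict_monoD)
    hence ne_H: "vset (H n) \<noteq> {}" if "n \<ge> 1" for n
      using that by (metis card.empty not_less_zero)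
    have "(\<lambda>n. hom_density F (H n)) \<sim>[sequentially] (\<lambda>_. p ^ ?j)"
    proof (rule asymp_equiv_of_power_sandwich[OF a])
      show "(\<lambda>n. hom_density ?K (H n)) \<sim>[sequentially] (\<lambda>_. p ^ (?j * ?k))"
        using g K by simp
      show "?k > 0"
        using ne finite_eset[OF assms(2)] by (simp add: card_gt_0_iff)
      show "\<forall>\<^sub>F n in sequentially. hom_density K2 (H n) ^ (?j * ?k) \<le> hom_density F (H n) ^ ?k"
        using lower[OF Hn ne_H] by (rule eventually_sequentiallyI)
      show "\<forall>\<^sub>F n in sequentially. hom_density F (H n) ^ ?k \<le> hom_density ?K (H n)"
        using upper[OF Hn ne_H] by (rule eventually_sequentiallyI)
    qed (use p in \<open>auto simp: hom_density_def\<close>)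
    thus "quasi_random p H"
      using forc p H a by (auto simp: forcing_def)
  qed
  ultimately show ?thesis
    by blast
qed

end
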